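(* Consider the discrete-time system $x_{k+1}=f(x_k,u_k)+w_k$ with state $x_k\in\mathcal{X}\subseteq\mathbb{R}^n$, input $u_k\in\mathcal{U}\subseteq\mathbb{R}^m$, disturbance $w_k\in\mathcal{W}\subseteq\mathbb{R}^n$, and $f:\mathcal{X}\times\mathcal{U}\to\mathcal{X}$. Let $\mathcal{K},\mathcal{T}\subseteq\mathcal{X}$ and $\mathcal{E}\subseteq\mathcal{W}$. Then the finite-time robust reach-avoid sets $\mathcal{D}_k(\mathcal{T},\mathcal{K},\mathcal{E})$ satisfy $$\mathcal{D}_0(\mathcal{T},\mathcal{K},\mathcal{E})=\mathcal{T},$$ and, for every $k\in\mathbb{N}$ with $k\ge 1$, $$\mathcal{D}_k(\mathcal{T},\mathcal{K},\mathcal{E})=\mathcal{K}\cap\mathscr{R}_1\big(\mathcal{D}_{k-1}(\mathcal{T},\mathcal{K},\mathcal{E})\ominus\mathcal{E}\big).$$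
   Context: The system is $x_{k+1}=f(x_k,u_k)+w_k$; all trajectories are understood to lie in the state space $\mathcal{X}$. It is assumed that $0_n\in\mathcal{W}$. $\mathbb{N}$ includes $0$, and $\mathbb{Z}_{[a,b]}=\{a,a+1,\dots,b\}$. A state-feedback law is any function $\nu:\mathcal{X}\to\mathcal{U}$ (no measurability required); $\mathcal{F}$ is the set of all of them. A control policy of length $t$ is a sequence $\rho_t=[\nu_0,\dots,\nu_{t-1}]$ with $\nu_k\in\mathcal{F}$; $\mathcal{P}_t$ is the set of these. Under $\rho_t$, $u_k=\nu_k(x_k)$. For $t\in\mathbb{N}$ and $\mathcal{E}\subseteq\mathcal{W}$, writing $\bar w_t=(w_0,\dots,w_{t-1})$, the $t$-time robust reach-avoid set is $$\mathcal{D}_t(\mathcal{T},\mathcal{K},\mathcal{E})=\{x_0\in\mathcal{X}:\exists\rho_t\in\mathcal{P}_t,\ \forall\bar w_t\in\mathcal{E}^t,\ \forall k\in\mathbb{Z}_{[0,t-1]},\ x_k\in\mathcal{K},\ \text{and } x_t\in\mathcal{T}\},$$ where $x_1,\dots,x_t$ is the trajectory generated from $x_0$ by $\rho_t$ and $\bar w_t$. The Minkowski (Pontryagin) difference is $\mathcal{S}_2\ominus\mathcal{S}_1=\{s: s+s_1\in\mathcal{S}_2\ \forall s_1\in\mathcal{S}_1\}$. The unperturbed one-step backward reach set is $\mathscr{R}_1(\mathcal{S})=\{x^-\in\mathcal{X}:\exists u\in\mathcal{U},\ \exists y\in\mathcal{S},\ y=f(x^-,u)\}$.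
   Formalization: The recursion for k ≥ 1 is stated for nonempty E only: if E is empty and U is not, the definition makes D_k all of X while the right-hand side is K, so the printed identity fails whenever K differs from X. *)

theory Defs
  imports "HOL-Analysis.Analysis"
begin

text \<open>
  The state space \<open>X\<close>, the input space \<open>U\<close> and the disturbance sets are carrier sets in Euclidean
  spaces; the dynamics \<open>f : X \<times> U \<rightarrow> X\<close> is a HOL function whose values outside \<open>X \<times> U\<close> are
  irrelevant.
\<close>

definition feedback_laws :: "'x set \<Rightarrow> 'u set \<Rightarrow> ('x \<Rightarrow> 'u) set" where
  "feedback_laws X U = X \<rightarrow>\<^sub>E U"

definition policies :: "'x set \<Rightarrow> 'u set \<Rightarrow> nat \<Rightarrow> ('x \<Rightarrow> 'u) list set" where
  "policies X U t = {\<rho>. length \<rho> = t \<and> set \<rho> \<subseteq> feedback_laws X U}"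

text \<open>The Cartesian power \<open>E\<^sup>t\<close>; in particular \<open>E\<^sup>0\<close> is the singleton of the empty sequence.\<close>

definition disturbances :: "'x set \<Rightarrow> nat \<Rightarrow> 'x list set" where
  "disturbances E t = {w. length w = t \<and> set w \<subseteq> E}"

text \<open>Only the values at times \<open>k \<le> length \<rho>\<close>, \<open>k \<le> length w\<close> are meaningful.\<close>

primrec trajectory ::
    "('x::plus \<times> 'u \<Rightarrow> 'x) \<Rightarrow> ('x \<Rightarrow> 'u) list \<Rightarrow> 'x list \<Rightarrow> 'x \<Rightarrow> nat \<Rightarrow> 'x" where
  "trajectory f \<rho> w x0 0 = x0"
| "trajectory f \<rho> w x0 (Suc k) =
     f (trajectory f \<rho> w x0 k, (\<rho> ! k) (trajectory f \<rho> w x0 k)) + w ! k"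

text \<open>
  A sum \<open>f (x, u) + w\<close> may fall outside \<open>X\<close>. For \<open>K \<subseteq> X\<close> and \<open>T \<subseteq> X\<close> the constraints below
  force every trajectory they concern to lie in \<open>X\<close>, so this is not demanded separately.
\<close>

definition reach_avoid ::
    "'x::plus set \<Rightarrow> 'u set \<Rightarrow> ('x \<times> 'u \<Rightarrow> 'x) \<Rightarrow> nat \<Rightarrow> 'x set \<Rightarrow> 'x set \<Rightarrow> 'x set \<Rightarrow> 'x set" where
  "reach_avoid X U f t T K E =
     {x0 \<in> X. \<exists>\<rho> \<in> policies X U t. \<forall>w \<in> disturbances E t.
        (\<forall>k<t. trajectory f \<rho> w x0 k \<in> K) \<and> trajectory f \<rho> w x0 t \<in> T}"

definition minkowski_diff :: "'x::plus set \<Rightarrow> 'x set \<Rightarrow> 'x set"  (infixl "\<ominus>" 65) where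
  "S2 \<ominus> S1 = {s. \<forall>s1 \<in> S1. s + s1 \<in> S2}"

definition backward_reach :: "'x set \<Rightarrow> 'u set \<Rightarrow> ('x \<times> 'u \<Rightarrow> 'x) \<Rightarrow> 'x set \<Rightarrow> 'x set" where
  "backward_reach X U f S = {x \<in> X. \<exists>u \<in> U. \<exists>y \<in> S. y = f (x, u)}"

end

theory Submission
  imports Defs
begin

text \<open>
  The first input of a successful policy must send the state into \<open>D\<^sub>k \<ominus> E\<close>. The
  converse is delicate because a policy may not depend on the disturbance: the states reached
  from \<open>x\<^sub>0\<close> at time 1 could call for different continuations. This is resolved by
  carrying a single policy through the recursion that succeeds from all points of \<open>D\<^sub>k\<close>
  simultaneously; it is extended by choosing a good input at every point of the next set.
\<close>

text \<open>The condition in \<open>reach_avoid\<close> with the policy as a parameter, so that one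
  policy can be required to succeed from many states at once.\<close>

definition enforces ::
    "('x::plus \<times> 'u \<Rightarrow> 'x) \<Rightarrow> nat \<Rightarrow> 'x set \<Rightarrow> 'x set \<Rightarrow> 'x set \<Rightarrow> ('x \<Rightarrow> 'u) list \<Rightarrow> 'x \<Rightarrow> bool" where
  "enforces f t T K E \<rho> x \<longleftrightarrow> (\<forall>w \<in> disturbances E t.
     (\<forall>k<t. trajectory f \<rho> w x k \<in> K) \<and> trajectory f \<rho> w x t \<in> T)"

lemma reach_avoid_iff:
  "x \<in> reach_avoid X U f t T K E \<longleftrightarrow> x \<in> X \<and> (\<exists>\<rho> \<in> policies X U t. enforces f t T K E \<rho> x)"
  by (simp add: reach_avoid_def enforces_def)

lemma policies_0 [simp]: "policies X U 0 = {[]}"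
  by (auto simp: policies_def)

lemma Cons_in_policies [simp]:
  "\<nu> # \<rho> \<in> policies X U (Suc t) \<longleftrightarrow> \<nu> \<in> feedback_laws X U \<and> \<rho> \<in> policies X U t"
  by (auto simp: policies_def)

lemma policies_SucE:
  assumes "\<rho> \<in> policies X U (Suc t)"
  obtains \<nu> \<rho>' where "\<rho> = \<nu> # \<rho>'" "\<nu> \<in> feedback_laws X U" "\<rho>' \<in> policies X U t"
  using assms by (cases \<rho>) (auto simp: policies_def)

lemma disturbances_0 [simp]: "disturbances E 0 = {[]}"
  by (auto simp: disturbances_def)

lemma Cons_in_disturbances [simp]:
  "e # w \<in> disturbances E (Suc t) \<longleftrightarrow> e \<in> E \<and> w \<in> disturbances E t"
  by (auto simp: disturbances_def)

lemma ball_disturbances_Suc: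
  "(\<forall>w \<in> disturbances E (Suc t). P w) \<longleftrightarrow> (\<forall>e \<in> E. \<forall>w \<in> disturbances E t. P (e # w))"
proof
  assume "\<forall>w \<in> disturbances E (Suc t). P w"
  then show "\<forall>e \<in> E. \<forall>w \<in> disturbances E t. P (e # w)" by simp
next
  assume R: "\<forall>e \<in> E. \<forall>w \<in> disturbances E t. P (e # w)"
  show "\<forall>w \<in> disturbances E (Suc t). P w"
  proof
    fix w assume w: "w \<in> disturbances E (Suc t)"
    then obtain e w' where "w = e # w'" by (cases w) (auto simp: disturbances_def)
    then show "P w" using R w by simp
  qed
qed

lemma disturbances_nonempty:
  assumes "E \<noteq> {}"
  shows "disturbances E t \<noteq> {}"
proof -
  obtain e where "e \<in> E" using assms by blast
  then have "replicate t e \<in> disturbances E t" by (auto simp: disturbances_def)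
  then show ?thesis by blast
qed

text \<open>\<open>trajectory\<close> recurses on the last step, while the backward recursion needs
  the first one removed: the tails then drive the trajectory from the state at time 1.\<close>

lemma trajectory_Cons:
  "trajectory f (\<nu> # \<rho>) (e # w) x (Suc k) = trajectory f \<rho> w (f (x, \<nu> x) + e) k"
  by (induction k) auto

lemma enforces_0 [simp]: "enforces f 0 T K E \<rho> x \<longleftrightarrow> x \<in> T"
  by (simp add: enforces_def)

text \<open>Time 0 is split off and the later times are shifted. As \<open>x \<in> K\<close> stands
  under quantifiers over \<open>e\<close> and \<open>w\<close>, extracting it takes an actual
  disturbance sequence; for empty \<open>E\<close> the left side would hold vacuously.\<close>

lemma enforces_Cons:
  assumes "E \<noteq> {}"
  shows "enforces f (Suc t) T K E (\<nu> # \<rho>) x \<longleftrightarrow>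
    x \<in> K \<and> (\<forall>e \<in> E. enforces f t T K E \<rho> (f (x, \<nu> x) + e))"
proof -
  have "enforces f (Suc t) T K E (\<nu> # \<rho>) x \<longleftrightarrow> (\<forall>e \<in> E. \<forall>w \<in> disturbances E t. x \<in> K \<and>
      (\<forall>k<t. trajectory f \<rho> w (f (x, \<nu> x) + e) k \<in> K) \<and> trajectory f \<rho> w (f (x, \<nu> x) + e) t \<in> T)"
    by (simp only: enforces_def ball_disturbances_Suc All_less_Suc2 trajectory_Cons trajectory.simps(1)
        conj_assoc)
  also have "\<dots> \<longleftrightarrow> x \<in> K \<and> (\<forall>e \<in> E. enforces f t T K E \<rho> (f (x, \<nu> x) + e))"
    using assms disturbances_nonempty[OF assms, of t] unfolding enforces_def by blast
  finally show ?thesis .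
qed

text \<open>Serves to show that successor states lie in \<open>X\<close>: the state at time 0 is in
  \<open>T\<close> if \<open>t = 0\<close> and in \<open>K\<close> otherwise.\<close>

lemma enforces_imp_mem:
  assumes "E \<noteq> {}" "enforces f t T K E \<rho> x"
  shows "x \<in> K \<union> T"
proof -
  obtain w where "w \<in> disturbances E t" using disturbances_nonempty[OF assms(1)] by blast
  then have "(\<forall>k<t. trajectory f \<rho> w x k \<in> K) \<and> trajectory f \<rho> w x t \<in> T"
    using assms(2) unfolding enforces_def by blast
  then show ?thesis by (cases t) (auto dest: spec[of _ 0])
qed

lemma reach_avoid_0:
  assumes "T \<subseteq> X"
  shows "reach_avoid X U f 0 T K E = T"
  using assms by (auto simp: reach_avoid_iff)

text \<open>The tail of a successful policy is itself a witness for every possible successor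
  state.\<close>

lemma reach_avoid_Suc_subset:
  assumes "E \<noteq> {}" "K \<subseteq> X" "T \<subseteq> X"
  shows "reach_avoid X U f (Suc t) T K E
    \<subseteq> K \<inter> backward_reach X U f (reach_avoid X U f t T K E \<ominus> E)"
proof
  fix x assume "x \<in> reach_avoid X U f (Suc t) T K E"
  then obtain \<nu> \<rho> where x: "x \<in> X" and \<nu>: "\<nu> \<in> feedback_laws X U" and \<rho>: "\<rho> \<in> policies X U t"
    and enf: "enforces f (Suc t) T K E (\<nu> # \<rho>) x"
    by (auto simp: reach_avoid_iff elim!: policies_SucE)
  have "f (x, \<nu> x) + e \<in> reach_avoid X U f t T K E" if "e \<in> E" for e
  proof -
    have enf': "enforces f t T K E \<rho> (f (x, \<nu> x) + e)"
      using enf that by (simp add: enforces_Cons[OF assms(1)])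
    moreover have "f (x, \<nu> x) + e \<in> X"
      using enforces_imp_mem[OF assms(1) enf'] assms(2,3) by blast
    ultimately show ?thesis using \<rho> by (auto simp: reach_avoid_iff)
  qed
  moreover have "\<nu> x \<in> U" using \<nu> x by (auto simp: feedback_laws_def)
  moreover have "x \<in> K" using enf by (simp add: enforces_Cons[OF assms(1)])
  ultimately show "x \<in> K \<inter> backward_reach X U f (reach_avoid X U f t T K E \<ominus> E)"
    using x by (auto simp: backward_reach_def minkowski_diff_def)
qed

lemma extend_uniform_policy:
  assumes "E \<noteq> {}" "\<rho> \<in> policies X U t" "\<And>y. y \<in> D \<Longrightarrow> enforces f t T K E \<rho> y"
    and ne: "K \<inter> backward_reach X U f (D \<ominus> E) \<noteq> {}"
  obtains \<rho>' where "\<rho>' \<in> policies X U (Suc t)"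
    "\<And>x. x \<in> K \<inter> backward_reach X U f (D \<ominus> E) \<Longrightarrow> enforces f (Suc t) T K E \<rho>' x"
proof -
  let ?B = "K \<inter> backward_reach X U f (D \<ominus> E)"
  \<comment> \<open>A default input for the states outside \<open>?B\<close>, where a feedback law
    must still take values in \<open>U\<close>.\<close>
  obtain u0 where "u0 \<in> U" using ne by (auto simp: backward_reach_def)
  moreover have "\<exists>u \<in> U. \<forall>e \<in> E. f (x, u) + e \<in> D" if "x \<in> ?B" for x
    using that by (auto simp: backward_reach_def minkowski_diff_def)
  ultimately have "\<forall>x. \<exists>u \<in> U. x \<in> ?B \<longrightarrow> (\<forall>e \<in> E. f (x, u) + e \<in> D)" by blast
  then obtain g where g: "\<And>x. g x \<in> U" "\<And>x e. x \<in> ?B \<Longrightarrow> e \<in> E \<Longrightarrow> f (x, g x) + e \<in> D"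
    by metis
  show ?thesis
  proof
    \<comment> \<open>Feedback laws are extensional on \<open>X\<close>; restricting
      \<open>g\<close> changes nothing on \<open>?B\<close>, which lies in \<open>X\<close>.\<close>
    show "restrict g X # \<rho> \<in> policies X U (Suc t)"
      using assms(2) g(1) by (simp add: feedback_laws_def)
    fix x assume x: "x \<in> ?B"
    then have "restrict g X x = g x" by (simp add: backward_reach_def)
    then show "enforces f (Suc t) T K E (restrict g X # \<rho>) x"
      using x g(2)[OF x] assms(3) by (simp add: enforces_Cons[OF assms(1)])
  qed
qed

text \<open>The induction needs only the inclusion already shown, so it can precede the equality.
  Nonemptiness matters: if \<open>U\<close> is empty and \<open>X\<close> is not, no policy of
  positive length exists.\<close>

lemma uniform_policy:
  assumes "E \<noteq> {}" "K \<subseteq> X" "T \<subseteq> X" "reach_avoid X U f t T K E \<noteq> {}"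
  shows "\<exists>\<rho> \<in> policies X U t. \<forall>x \<in> reach_avoid X U f t T K E. enforces f t T K E \<rho> x"
  using assms(4)
proof (induction t)
  case 0
  show ?case by (simp add: reach_avoid_0[OF assms(3)])
next
  case (Suc t)
  let ?D = "reach_avoid X U f t T K E"
  note sub = reach_avoid_Suc_subset[OF assms(1-3), of U f t]
  then have ne: "K \<inter> backward_reach X U f (?D \<ominus> E) \<noteq> {}"
    using Suc.prems by blast
  \<comment> \<open>A point of \<open>?D \<ominus> E\<close> plus any element of \<open>E\<close> is
    a point of \<open>?D\<close>.\<close>
  then have "?D \<noteq> {}"
    using assms(1) by (auto simp: backward_reach_def minkowski_diff_def)
  then obtain \<rho> where "\<rho> \<in> policies X U t" "\<And>y. y \<in> ?D \<Longrightarrow> enforces f t T K E \<rho> y"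
    using Suc.IH by blast
  from extend_uniform_policy[OF assms(1) this ne] obtain \<rho>' where
    "\<rho>' \<in> policies X U (Suc t)"
    "\<And>x. x \<in> K \<inter> backward_reach X U f (?D \<ominus> E) \<Longrightarrow> enforces f (Suc t) T K E \<rho>' x"
    by blast
  with sub show ?case by blast
qed

lemma reach_avoid_Suc:
  assumes "E \<noteq> {}" "K \<subseteq> X" "T \<subseteq> X"
  shows "reach_avoid X U f (Suc t) T K E
    = K \<inter> backward_reach X U f (reach_avoid X U f t T K E \<ominus> E)"
proof
  let ?D = "reach_avoid X U f t T K E"
  let ?B = "K \<inter> backward_reach X U f (?D \<ominus> E)"
  show "reach_avoid X U f (Suc t) T K E \<subseteq> ?B"
    by (rule reach_avoid_Suc_subset[OF assms])
  show "?B \<subseteq> reach_avoid X U f (Suc t) T K E"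
  \<comment> \<open>A nonempty \<open>?B\<close> makes \<open>?D\<close> nonempty and
    \<open>U\<close> inhabited, as the uniform policy and its extension require.\<close>
  proof (cases "?B = {}")
    case False
    then have "?D \<noteq> {}"
      using assms(1) by (auto simp: backward_reach_def minkowski_diff_def)
    then obtain \<rho> where "\<rho> \<in> policies X U t" "\<And>y. y \<in> ?D \<Longrightarrow> enforces f t T K E \<rho> y"
      using uniform_policy[OF assms] by blast
    from extend_uniform_policy[OF assms(1) this False] obtain \<rho>' where
      "\<rho>' \<in> policies X U (Suc t)" "\<And>x. x \<in> ?B \<Longrightarrow> enforces f (Suc t) T K E \<rho>' x"
      by blast
    then show ?thesis
      using assms(2) unfolding reach_avoid_iff subset_iff by blast
  qed simp
qed

text \<open>The recursion is claimed for nonempty \<open>E\<close>. If \<open>E\<close> is empty and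
  \<open>U\<close> is not, then for \<open>k \<ge> 1\<close> the left side is all of
  \<open>X\<close> vacuously, whereas the right side is \<open>K\<close>.\<close>

theorem theorem1:
  fixes X W T K E :: "(real ^ 'n) set"
    and U :: "(real ^ 'm) set"
    and f :: "(real ^ 'n) \<times> (real ^ 'm) \<Rightarrow> real ^ 'n"
  assumes "f \<in> X \<times> U \<rightarrow> X"
    and "0 \<in> W"
    and "K \<subseteq> X" and "T \<subseteq> X" and "E \<subseteq> W"
  shows "reach_avoid X U f 0 T K E = T \<and>
    (E \<noteq> {} \<longrightarrow>
      (\<forall>k\<ge>1. reach_avoid X U f k T K E =
         K \<inter> backward_reach X U f (reach_avoid X U f (k - 1) T K E \<ominus> E)))"
proof (intro conjI impI allI)
  show "reach_avoid X U f 0 T K E = T" by (rule reach_avoid_0[OF assms(4)])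
next
  fix k :: nat assume "E \<noteq> {}" "1 \<le> k"
  then show "reach_avoid X U f k T K E =
      K \<inter> backward_reach X U f (reach_avoid X U f (k - 1) T K E \<ominus> E)"
    using reach_avoid_Suc[OF _ assms(3,4), of E U f "k - 1"] by simp
qed

end
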